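(* Let $n, m$ be positive integers, let $k \ge 0$ be an integer, and let $A = \{0 \le a_1 \le a_2 \le \ldots \le a_m \le n-1\}$ be a sequence of $m$ integers. Then Algorithm 1 under input $A$ yields a minimum partition of $A$ into $k$-small subsequences: its output $A_1, A_2, \ldots, A_s$ is a partition of $A$ into $s$ $k$-small subsequences, and $s$ is the minimum number of $k$-small subsequences into which $A$ can be partitioned.
   Context: Fix positive integers $n,m$ and an integer $k\ge 0$. A sequence $A = \{0 \le a_1 \le \ldots \le a_m \le n-1\}$ consists of $m$ integers (repetitions allowed; entries are distinguished by their indices, and $|\cdot|$ counts entries with multiplicity). A subsequence $A'$ of $A$ is called $k$-small if every member $x$ of $A'$ satisfies $x \le n - |A'| + k$ (here $n$ is the fixed integer above). Algorithm 1 (input $A$): Set $i := 0$ and $R_0 := A$. Repeat the following until $R_i = \emptyset$: (1) $n_i := |R_i|$; (2) $p_i := \min\{n_i,\, n - a_{n_i} + k\}$; (3) $A_{i+1} := \{a_{n_i - p_i + 1}, a_{n_i - p_i + 2}, \ldots, a_{n_i}\}$; (4) $R_{i+1} := R_i \setminus A_{i+1}$; (5) $i := i+1$. Output: $s := i$ and $A_1, A_2, \ldots, A_s$. (Thus each $R_i$ is the initial segment $a_1, \ldots, a_{n_i}$ of the sequence.) *)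

theory Defs
  imports Complex_Main "HOL-Library.Disjoint_Sets" "HOL-Library.While_Combinator"
begin

text \<open>
  The sequence is given by a function \<open>a\<close> of which only \<open>a 1, \<dots>, a m\<close> matter. Entries are
  distinguished by their indices, so a subsequence is a set of indices \<open>I \<subseteq> {1..m}\<close>, and \<open>card I\<close>
  counts its entries with multiplicity. The bound is taken over the integers
  because \<open>card I\<close> may exceed \<open>n + k\<close>.
\<close>

definition k_small :: "nat \<Rightarrow> nat \<Rightarrow> (nat \<Rightarrow> int) \<Rightarrow> nat set \<Rightarrow> bool" where
  "k_small n k a I \<longleftrightarrow> (\<forall>i\<in>I. a i \<le> int n - int (card I) + int k)"

definition k_small_partition ::
    "nat \<Rightarrow> nat \<Rightarrow> nat \<Rightarrow> (nat \<Rightarrow> int) \<Rightarrow> nat set set \<Rightarrow> bool" where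
  "k_small_partition n k m a P \<longleftrightarrow> partition_on {1..m} P \<and> (\<forall>I\<in>P. k_small n k a I)"

text \<open>
  The loop state \<open>(i, R, A)\<close> consists of the counter, the index set of \<open>R\<^sub>i\<close>, and the
  parts found so far, stored as \<open>A 1, \<dots>, A i\<close>.
\<close>

definition alg1_step ::
    "nat \<Rightarrow> nat \<Rightarrow> (nat \<Rightarrow> int) \<Rightarrow>
      nat \<times> nat set \<times> (nat \<Rightarrow> nat set) \<Rightarrow> nat \<times> nat set \<times> (nat \<Rightarrow> nat set)" where
  "alg1_step n k a = (\<lambda>(i, R, A).
     let ni = card R;
         p = min (int ni) (int n - a ni + int k);
         B = {j. int ni - p + 1 \<le> int j \<and> j \<le> ni}
     in (i + 1, R - B, A(i + 1 := B)))"

text \<open>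
  The result is \<open>None\<close> if the loop does not terminate, and otherwise \<open>Some (s, A)\<close>, where
  the output parts are \<open>A 1, \<dots>, A s\<close>.
\<close>

definition alg1 :: "nat \<Rightarrow> nat \<Rightarrow> nat \<Rightarrow> (nat \<Rightarrow> int) \<Rightarrow> (nat \<times> (nat \<Rightarrow> nat set)) option" where
  "alg1 n k m a =
     map_option (\<lambda>(s, R, A). (s, A))
       (while_option (\<lambda>(i, R, A). R \<noteq> {}) (alg1_step n k a) (0, {1..m}, \<lambda>_. {}))"

end

theory Submission imports Defs begin

text \<open>
  Every part contains at least one index since every entry is at most \<open>n - 1\<close>, so the algorithm
  terminates. For minimality, run the algorithm against an arbitrary \<open>k\<close>-small partition \<open>P\<close>: in
  every round discard from \<open>P\<close> the part that contains the largest index \<open>x\<close> still covered. As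
  long as the parts left cover at least \<open>t = n\<^sub>i\<close> indices, \<open>x \<ge> t\<close>, so \<open>k\<close>-smallness
  bounds the discarded part by \<open>n - a x + k \<le> n - a t + k\<close>; hence it has at most \<open>p\<^sub>i\<close>
  entries or at least \<open>t\<close> of them, and the parts left cover at least \<open>t - p\<^sub>i = n\<^sub>i\<^sub>+\<^sub>1\<close> indices.
  Thus \<open>P\<close> cannot be used up before the algorithm stops.
\<close>

text \<open>This is \<open>p\<^sub>i\<close> for a prefix of length \<open>t\<close>, as a natural
  number. When \<open>a t < int n\<close> the minimum is nonnegative, so \<open>nat\<close> does not
  change it.\<close>

definition greedy_size :: "nat \<Rightarrow> nat \<Rightarrow> (nat \<Rightarrow> int) \<Rightarrow> nat \<Rightarrow> nat" where
  "greedy_size n k a t = nat (min (int t) (int n - a t + int k))"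

lemma greedy_size_le: "greedy_size n k a t \<le> t"
  by (simp add: greedy_size_def)

lemma greedy_size_pos:
  assumes "0 < t" "a t < int n"
  shows "0 < greedy_size n k a t"
  using assms by (simp add: greedy_size_def)

lemma alg1_step_prefix:
  assumes "0 < t" "a t < int n"
  shows "alg1_step n k a (i, {1..t}, A) =
    (i + 1, {1..t - greedy_size n k a t}, A(i + 1 := {t - greedy_size n k a t<..t}))"
proof -
  define q where "q = greedy_size n k a t"
  have q: "q \<le> t" "min (int t) (int n - a t + int k) = int q"
    using assms by (auto simp: q_def greedy_size_def)
  have "{j. int t - int q + 1 \<le> int j \<and> j \<le> t} = {t - q<..t}"
    using q(1) by auto
  moreover have "{1..t} - {t - q<..t} = {1..t - q}"
    by auto
  ultimately show ?thesis
    using q(2) by (simp add: alg1_step_def Let_def flip: q_def)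
qed

text \<open>By monotonicity \<open>a t\<close> is the largest entry of the block, and the minimum
  keeps the block size at most \<open>n - a t + k\<close>.\<close>

lemma k_small_greedy_block:
  assumes "mono_on {1..t} a" "a t < int n"
  shows "k_small n k a {t - greedy_size n k a t<..t}"
  unfolding k_small_def
proof
  fix j assume j: "j \<in> {t - greedy_size n k a t<..t}"
  have "a j \<le> a t"
    using j by (intro mono_onD[OF assms(1)]) auto
  moreover have "int (card {t - greedy_size n k a t<..t}) \<le> int n - a t + int k"
    using assms(2) greedy_size_le[of n k a t] by (simp add: greedy_size_def)
  ultimately show "a j \<le> int n - int (card {t - greedy_size n k a t<..t}) + int k"
    by linarith
qed

lemma card_le_Max_pos:
  fixes S :: "nat set"
  assumes "finite S" "0 \<notin> S"
  shows "card S \<le> Max S"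
proof -
  have "S \<subseteq> {1..Max S}"
    using assms by (auto simp: Suc_le_eq intro: gr0I)
  then show ?thesis
    using card_mono[of "{1..Max S}" S] by simp
qed

lemma k_small_family_discard:
  assumes mono: "mono_on {1..m} a"
    and Q: "finite Q" "\<Union>Q \<subseteq> {1..m}" "\<forall>I\<in>Q. k_small n k a I"
    and t: "0 < t" "t \<le> card (\<Union>Q)"
  obtains I where "I \<in> Q" "t - greedy_size n k a t \<le> card (\<Union>(Q - {I}))"
proof -
  define x where "x = Max (\<Union>Q)"
  have fin: "finite (\<Union>Q)"
    using Q(2) finite_subset by blast
  moreover have "\<Union>Q \<noteq> {}"
    using t by (metis card.empty not_le)
  ultimately have x: "x \<in> \<Union>Q"
    unfolding x_def by (rule Max_in)
  then obtain I where I: "I \<in> Q" "x \<in> I"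
    by blast
  \<comment> \<open>The union consists of positive indices, so its maximum is at least its
    cardinality.\<close>
  have "t \<le> x"
    using card_le_Max_pos[OF fin] Q(2) t(2) unfolding x_def by force
  moreover have "x \<le> m"
    using x Q(2) by auto
  ultimately have "a t \<le> a x"
    using t(1) by (intro mono_onD[OF mono]) auto
  moreover have "a x \<le> int n - int (card I) + int k"
    using I Q(3) by (auto simp: k_small_def)
  \<comment> \<open>If the minimum is \<open>t\<close>, the left side is 0; otherwise it is
    \<open>n - a t + k\<close>, which is at least \<open>card I\<close> because
    \<open>a t \<le> a x\<close>.\<close>
  ultimately have "t - greedy_size n k a t \<le> t - card I"
    unfolding greedy_size_def by linarith
  also have "\<dots> \<le> card (\<Union>Q - I)"
    using t(2) diff_card_le_card_Diff[of I "\<Union>Q"] fin I(1) finite_subset[of I "\<Union>Q"]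
    by fastforce
  also have "\<dots> \<le> card (\<Union>(Q - {I}))"
    using fin by (intro card_mono) (auto intro: finite_subset)
  finally show ?thesis
    using that I(1) by blast
qed

text \<open>Blocks are cut off from the top, so those found so far partition \<open>{t<..m}\<close>,
  and \<open>inj_on\<close> makes \<open>i\<close> their exact number. The last conjunct carries the
  lower bound: any competitor \<open>P\<close> can lose at least \<open>i\<close> members and still
  cover \<open>t\<close> indices.\<close>

definition alg1_invariant ::
    "nat \<Rightarrow> nat \<Rightarrow> nat \<Rightarrow> (nat \<Rightarrow> int) \<Rightarrow> nat \<times> nat set \<times> (nat \<Rightarrow> nat set) \<Rightarrow> bool" where
  "alg1_invariant n k m a = (\<lambda>(i, R, A). \<exists>t\<le>m. R = {1..t}
     \<and> inj_on A {1..i} \<and> partition_on {t<..m} (A ` {1..i}) \<and> (\<forall>I\<in>A ` {1..i}. k_small n k a I)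
     \<and> (\<forall>P. k_small_partition n k m a P \<longrightarrow>
          (\<exists>Q\<subseteq>P. card Q + i \<le> card P \<and> t \<le> card (\<Union>Q))))"

lemma alg1_invariant_init: "alg1_invariant n k m a (0, {1..m}, \<lambda>_. {})"
  unfolding alg1_invariant_def
  \<comment> \<open>Before the first round \<open>t = m\<close>, and \<open>Q = P\<close>
    serves.\<close>
  by (auto simp: k_small_partition_def partition_on_def intro!: exI[of _ m])

text \<open>The decreasing cardinality serves as termination measure; it drops because the new block
  is nonempty.\<close>

lemma alg1_invariant_step:
  assumes mono: "mono_on {1..m} a" and lt: "\<forall>i\<in>{1..m}. a i < int n"
    and inv: "alg1_invariant n k m a (i, R, A)" and "R \<noteq> {}"
  shows "alg1_invariant n k m a (alg1_step n k a (i, R, A))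
    \<and> card (fst (snd (alg1_step n k a (i, R, A)))) < card R"
proof -
  obtain t where t: "t \<le> m" "R = {1..t}"
    and inj: "inj_on A {1..i}" and part: "partition_on {t<..m} (A ` {1..i})"
    and small: "\<forall>I\<in>A ` {1..i}. k_small n k a I"
    and low: "\<And>P. k_small_partition n k m a P \<Longrightarrow>
      \<exists>Q\<subseteq>P. card Q + i \<le> card P \<and> t \<le> card (\<Union>Q)"
    using inv unfolding alg1_invariant_def by auto
  have t0: "0 < t" and at: "a t < int n"
    using \<open>R \<noteq> {}\<close> t lt by auto
  define q where "q = greedy_size n k a t"
  define B where "B = {t - q<..t}"
  define A' where "A' = A(i + 1 := B)"
  have q: "0 < q" "q \<le> t"
    unfolding q_def using greedy_size_pos[of t a n k] t0 at greedy_size_le by auto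
  have step: "alg1_step n k a (i, R, A) = (i + 1, {1..t - q}, A')"
    unfolding t(2) A'_def B_def q_def by (rule alg1_step_prefix[where a = a, OF t0 at])
  have Suc: "{1..i + 1} = insert (i + 1) {1..i}"
    by auto
  have A': "A' (i + 1) = B" "A' ` {1..i} = A ` {1..i}"
    by (auto simp: A'_def image_iff)
  have img: "A' ` {1..i + 1} = insert B (A ` {1..i})"
    unfolding Suc image_insert A' ..
  have "B \<noteq> {}"
    using q by (auto simp: B_def)
  have union: "\<Union>(A ` {1..i}) = {t<..m}"
    using partition_onD1[OF part] by (rule sym)
  have disj: "disjnt B (\<Union>(A ` {1..i}))"
    unfolding union by (auto simp: B_def disjnt_def)
  \<comment> \<open>A nonempty set disjoint from all earlier blocks equals none of them; this keeps
    the blocks distinct.\<close>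
  then have "B \<notin> A ` {1..i}"
    using \<open>B \<noteq> {}\<close> unfolding disjnt_def by blast
  moreover have "inj_on A' {1..i}"
    using inj by (rule inj_on_cong[THEN iffD1, rotated]) (simp add: A'_def)
  ultimately have inj': "inj_on A' {1..i + 1}"
    unfolding Suc inj_on_insert using A' by blast
  have "{t - q<..m} - B = {t<..m}" "B \<subseteq> {t - q<..m}"
    using t(1) by (auto simp: B_def)
  then have part': "partition_on {t - q<..m} (A' ` {1..i + 1})"
    unfolding img partition_on_insert[OF disj] using part \<open>B \<noteq> {}\<close> by simp
  have "k_small n k a B"
    unfolding B_def q_def using mono_on_subset[OF mono] t(1) at
    by (intro k_small_greedy_block) auto
  then have small': "\<forall>I\<in>A' ` {1..i + 1}. k_small n k a I"
    using small unfolding img by blast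
  have low': "\<exists>Q\<subseteq>P. card Q + (i + 1) \<le> card P \<and> t - q \<le> card (\<Union>Q)"
    if P: "k_small_partition n k m a P" for P
  proof -
    obtain Q where Q: "Q \<subseteq> P" "card Q + i \<le> card P" "t \<le> card (\<Union>Q)"
      using low[OF P] by blast
    have "finite P" "\<Union>P = {1..m}" "\<forall>I\<in>P. k_small n k a I"
      using P finite_elements[of "{1..m}" P]
      by (auto simp: k_small_partition_def partition_on_def)
    then have "finite Q" "\<Union>Q \<subseteq> {1..m}" "\<forall>I\<in>Q. k_small n k a I"
      using Q(1) finite_subset by blast+
    \<comment> \<open>The new block is paid for by one more member of the competitor.\<close>
    then obtain I where I: "I \<in> Q" "t - q \<le> card (\<Union>(Q - {I}))"
      using k_small_family_discard[OF mono _ _ _ t0 Q(3)] unfolding q_def by metis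
    have "card (Q - {I}) + 1 = card Q"
      using card_Suc_Diff1[OF \<open>finite Q\<close> I(1)] by simp
    then show ?thesis
      using Q I(2) by (intro exI[of _ "Q - {I}"]) auto
  qed
  have "alg1_invariant n k m a (i + 1, {1..t - q}, A')"
    unfolding alg1_invariant_def using t(1) inj' part' small' low'
    by (auto intro!: exI[of _ "t - q"] simp del: image_Suc_atLeastAtMost)
  then show ?thesis
    unfolding step using q t(2) by simp
qed

theorem theorem3p1:
  fixes n m k :: nat and a :: "nat \<Rightarrow> int"
  assumes "n > 0" and "m > 0"
    and "mono_on {1..m} a"
    and "\<forall>i\<in>{1..m}. 0 \<le> a i \<and> a i \<le> int n - 1"
  shows "\<exists>s A. alg1 n k m a = Some (s, A)
           \<and> inj_on A {1..s}
           \<and> k_small_partition n k m a (A ` {1..s})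
           \<and> (\<forall>P. k_small_partition n k m a P \<longrightarrow> s \<le> card P)"
proof -
  let ?b = "\<lambda>(i::nat, R::nat set, A::nat \<Rightarrow> nat set). R \<noteq> {}"
  let ?s0 = "(0::nat, {1..m}, \<lambda>_. {})"
  have lt: "\<forall>i\<in>{1..m}. a i < int n"
    using assms(4) by force
  have step: "alg1_invariant n k m a (alg1_step n k a st)
      \<and> card (fst (snd (alg1_step n k a st))) < card (fst (snd st))"
    if "alg1_invariant n k m a st" "?b st" for st
    using that alg1_invariant_step[OF assms(3) lt] by (cases st) simp
  obtain st where st: "while_option ?b (alg1_step n k a) ?s0 = Some st"
    using measure_while_option_Some[of "alg1_invariant n k m a" ?b "alg1_step n k a"
        "\<lambda>st. card (fst (snd st))" ?s0] step alg1_invariant_init by blast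
  obtain s R A where sRA: "st = (s, R, A)"
    by (cases st)
  have "R = {}"
    using while_option_stop[OF st] by (simp add: sRA)
  moreover have "alg1_invariant n k m a st"
    using while_option_rule[OF _ st, of "alg1_invariant n k m a"] step alg1_invariant_init
    by blast
  \<comment> \<open>The empty remainder forces \<open>t = 0\<close>, so the blocks now cover every
    index.\<close>
  ultimately have inj: "inj_on A {1..s}"
    and part: "partition_on {0<..m} (A ` {1..s})" "\<forall>I\<in>A ` {1..s}. k_small n k a I"
    and low: "\<forall>P. k_small_partition n k m a P \<longrightarrow> (\<exists>Q\<subseteq>P. card Q + s \<le> card P)"
    by (auto simp: alg1_invariant_def sRA Suc_le_eq)
  have "{0<..m} = {1..m}"
    by auto
  then have "k_small_partition n k m a (A ` {1..s})"
    using part by (simp add: k_small_partition_def)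
  moreover have "\<forall>P. k_small_partition n k m a P \<longrightarrow> s \<le> card P"
    using low add_leD2 by blast
  moreover have "alg1 n k m a = Some (s, A)"
    using st by (simp add: alg1_def sRA)
  ultimately show ?thesis
    using inj by blast
qed

end
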